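(* Let $k\ge3$, $\ell\ge2$ be natural numbers and $\lambda>\aleph_0$ a cardinal. Then there exists a $(k,\ell)$-partition $G=(V,E_1,\dots,E_\ell)$ with $|V|=2^{\aleph_0}$ and an injective $\omega$-automatic presentation $(L,h)$ of $G$ such that there is no $H\subseteq L$ for which $h(H)$ is homogeneous in $G$ and of size $\lambda$.
   Context: For a set $V$ and $k\ge1$, $[V]^k$ is the set of $k$-element subsets of $V$. A $(k,\ell)$-partition is a tuple $(V,E_1,\dots,E_\ell)$ with $(E_1,\dots,E_\ell)$ a partition of $[V]^k$ into possibly empty sets; $W\subseteq V$ is homogeneous if $[W]^k\subseteq E_i$ for some $i$. A relation on $\omega$-words is $\omega$-automatic if the set of convolutions of its tuples (the $\omega$-words over the product alphabet read synchronously) is a regular $\omega$-language. An injective $\omega$-automatic presentation is a pair $(L,h)$ with $L$ a regular $\omega$-language and $h:L\to V$ a bijection such that $\{(x_1,\dots,x_k)\in L^k\mid\{h(x_1),\dots,h(x_k)\}\in E_i\}$ ($1\le i\le\ell$) and $\{(x,y)\in L^2\mid h(x)=h(y)\}$ are $\omega$-automatic. *)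

theory Defs
  imports Main "HOL-Library.Ramsey" "HOL-Library.Disjoint_Sets" "HOL-Library.Omega_Words_Fun"
begin

unbundle cardinal_syntax

section \<open>Regular \<open>\<omega>\<close>-languages\<close>

record ('q, 'a) buchi =
  states :: "'q set"
  initial :: "'q set"
  transitions :: "('q \<times> 'a \<times> 'q) set"
  final :: "'q set"

definition buchi_automaton :: "'a set \<Rightarrow> ('q, 'a) buchi \<Rightarrow> bool" where
  "buchi_automaton \<Sigma> A \<longleftrightarrow>
     finite \<Sigma> \<and> finite (states A) \<and>
     initial A \<subseteq> states A \<and> final A \<subseteq> states A \<and>
     transitions A \<subseteq> states A \<times> \<Sigma> \<times> states A"

definition accepting_run :: "('q, 'a) buchi \<Rightarrow> 'a word \<Rightarrow> 'q word \<Rightarrow> bool" where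
  "accepting_run A w r \<longleftrightarrow>
     r 0 \<in> initial A \<and>
     (\<forall>n. (r n, w n, r (Suc n)) \<in> transitions A) \<and>
     limit r \<inter> final A \<noteq> {}"

definition buchi_language :: "('q, 'a) buchi \<Rightarrow> 'a word set" where
  "buchi_language A = {w. \<exists>r. accepting_run A w r}"

text \<open>States are natural numbers; since state sets are finite, this is no restriction.\<close>

definition omega_regular :: "'a set \<Rightarrow> 'a word set \<Rightarrow> bool" where
  "omega_regular \<Sigma> L \<longleftrightarrow>
     (\<exists>A :: (nat, 'a) buchi. buchi_automaton \<Sigma> A \<and> buchi_language A = L)"


section \<open>\<open>\<omega>\<close>-automatic relations\<close>

text \<open>A \<open>k\<close>-tuple of \<open>\<omega>\<close>-words is a list of length \<open>k\<close>, and the letters of the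
  product alphabet \<open>\<Sigma>\<^sup>k\<close> are the lists of length \<open>k\<close> over \<open>\<Sigma>\<close>.\<close>

definition convolution :: "'a word list \<Rightarrow> 'a list word" where
  "convolution xs = (\<lambda>n. map (\<lambda>x. x n) xs)"

definition product_alphabet :: "'a set \<Rightarrow> nat \<Rightarrow> 'a list set" where
  "product_alphabet \<Sigma> k = {as. length as = k \<and> set as \<subseteq> \<Sigma>}"

definition omega_automatic :: "'a set \<Rightarrow> nat \<Rightarrow> 'a word list set \<Rightarrow> bool" where
  "omega_automatic \<Sigma> k R \<longleftrightarrow> omega_regular (product_alphabet \<Sigma> k) (convolution ` R)"


section \<open>\<open>(k, \<ell>)\<close>-partitions and their presentations\<close>

text \<open>The classes \<open>E\<^sub>1, \<dots>, E\<^sub>\<ell>\<close> are the values of \<open>E\<close> on \<open>{1..\<ell>}\<close>;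
  other values of \<open>E\<close> are irrelevant.\<close>

definition kl_partition :: "nat \<Rightarrow> nat \<Rightarrow> 'v set \<Rightarrow> (nat \<Rightarrow> 'v set set) \<Rightarrow> bool" where
  "kl_partition k l V E \<longleftrightarrow>
     (\<Union>i\<in>{1..l}. E i) = nsets V k \<and> disjoint_family_on E {1..l}"

definition homogeneous ::
    "nat \<Rightarrow> nat \<Rightarrow> 'v set \<Rightarrow> (nat \<Rightarrow> 'v set set) \<Rightarrow> 'v set \<Rightarrow> bool" where
  "homogeneous k l V E W \<longleftrightarrow> W \<subseteq> V \<and> (\<exists>i\<in>{1..l}. nsets W k \<subseteq> E i)"

definition injective_omega_automatic_presentation ::
    "nat \<Rightarrow> nat \<Rightarrow> 'v set \<Rightarrow> (nat \<Rightarrow> 'v set set) \<Rightarrow> 'a word set \<Rightarrow> ('a word \<Rightarrow> 'v) \<Rightarrow> bool" where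
  "injective_omega_automatic_presentation k l V E L h \<longleftrightarrow>
     (\<exists>\<Sigma>. finite \<Sigma> \<and> omega_regular \<Sigma> L \<and> bij_betw h L V \<and>
        (\<forall>i\<in>{1..l}. omega_automatic \<Sigma> k
            {xs. length xs = k \<and> set xs \<subseteq> L \<and> h ` set xs \<in> E i}) \<and>
        omega_automatic \<Sigma> 2 {[x, y] | x y. x \<in> L \<and> y \<in> L \<and> h x = h y})"

end

(* Colour a k-set of binary words by whether exactly one member has bit 0 at the first position
   where the members do not all agree. An uncountable set H of words has a prefix after which
   infinitely many members of H continue with 0 and infinitely many with 1: the members having
   only finitely many companions on some prefix are countably many, and two of the remaining
   ones branch as required. One word from the 0-side and k - 1 from the 1-side form a set of
   one colour, two words from the 0-side and k - 2 >= 1 from the 1-side a set of the other.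
   The colour of a tuple and the pairs of its components that differ are both determined by a
   finite prefix, so a deterministic automaton can read them off. *)
theory Submission
  imports Defs "HOL-Library.Countable_Set_Type"
begin

section \<open>Uncountable sets of binary words branch\<close>

text \<open>Over a countable alphabet there are only countably many finite words, so the members of
  \<open>H\<close> with a finite class for some prefix lie in a countable union of finite sets.
  Uncountably many remain; any two distinct ones serve.\<close>

lemma uncountable_infinite_prefix_classes:
  fixes H :: "'a::countable word set"
  assumes "uncountable H"
  obtains x y where "x \<in> H" "y \<in> H" "x \<noteq> y"
    "\<And>n. infinite {z \<in> H. prefix n z = prefix n x}"
    "\<And>n. infinite {z \<in> H. prefix n z = prefix n y}"
proof -
  define X where "X = {x \<in> H. \<exists>n. finite {z \<in> H. prefix n z = prefix n x}}"
  define P where "P = {p. finite {z \<in> H. prefix (length p) z = p}}"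
  have "X \<subseteq> (\<Union>p\<in>P. {z \<in> H. prefix (length p) z = p})"
  proof
    fix x assume "x \<in> X"
    then obtain n where n: "x \<in> H" "finite {z \<in> H. prefix n z = prefix n x}"
      unfolding X_def by blast
    then have "prefix n x \<in> P"
      unfolding P_def by simp
    then show "x \<in> (\<Union>p\<in>P. {z \<in> H. prefix (length p) z = p})"
      using n by (intro UN_I[of "prefix n x"]) auto
  qed
  moreover have "countable (\<Union>p\<in>P. {z \<in> H. prefix (length p) z = p})"
    by (intro countable_UN) (auto simp: P_def countable_finite)
  ultimately have "countable X"
    by (rule countable_subset)
  with assms have "uncountable (H - X)"
    by (rule uncountable_minus_countable)
  then have "infinite (H - X)"
    using countable_finite by blast
  then obtain x where x: "x \<in> H - X"
    by (metis finite.emptyI ex_in_conv)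
  with \<open>infinite (H - X)\<close> obtain y where "y \<in> H - X" "y \<noteq> x"
    by (metis finite.emptyI finite_insert insertCI finite_subset subsetI)
  with x show thesis
    unfolding X_def by (intro that[of x y]) auto
qed

lemma uncountable_branching:
  fixes H :: "nat word set"
  assumes "uncountable H" and binary: "H \<subseteq> {w. \<forall>n. w n \<in> {0, 1}}"
  obtains n u where "infinite {z \<in> H. prefix n z = u \<and> z n = 0}"
    "infinite {z \<in> H. prefix n z = u \<and> z n = 1}"
proof -
  obtain x y where xy: "x \<in> H" "y \<in> H" "x \<noteq> y"
    "\<And>n. infinite {z \<in> H. prefix n z = prefix n x}"
    "\<And>n. infinite {z \<in> H. prefix n z = prefix n y}"
    by (rule uncountable_infinite_prefix_classes[OF assms(1)], rule that)
  then obtain m where "x m \<noteq> y m"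
    by blast
  define n where "n = (LEAST n. x n \<noteq> y n)"
  have n: "x n \<noteq> y n"
    unfolding n_def using \<open>x m \<noteq> y m\<close> by (rule LeastI)
  have "\<And>m. m < n \<Longrightarrow> x m = y m"
    using not_less_Least unfolding n_def by blast
  then have same: "prefix n x = prefix n y"
    by (simp add: subsequence_def)
  have side: "infinite {z \<in> H. prefix n z = prefix n x \<and> z n = v n}"
    if "v \<in> {x, y}" for v
  proof -
    \<comment> \<open>Lengthening the common prefix by one letter fixes the bit at \<open>n\<close>,
      so the infinite class of \<open>v\<close> lies on one side of the branching.\<close>
    have "{z \<in> H. prefix (Suc n) z = prefix (Suc n) v} \<subseteq>
        {z \<in> H. prefix n z = prefix n x \<and> z n = v n}"
      using that same by (auto simp: subsequence_def)
    moreover have "infinite {z \<in> H. prefix (Suc n) z = prefix (Suc n) v}"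
      using that xy(4,5) by blast
    ultimately show ?thesis
      by (rule infinite_super)
  qed
  have "x n \<in> {0, 1}" "y n \<in> {0, 1}"
    using binary xy(1,2) by auto
  with n have "x n = 0 \<and> y n = 1 \<or> x n = 1 \<and> y n = 0"
    by auto
  with side[of x] side[of y] that show thesis
    by auto
qed


section \<open>The colouring\<close>

text \<open>When \<open>S\<close> has at least two members, a lone zero at \<open>n\<close> already
  means disagreement there, so \<open>n\<close> is the first position of disagreement.\<close>

definition lone_zero :: "nat word set \<Rightarrow> bool" where
  "lone_zero S \<longleftrightarrow>
     (\<exists>n. (\<exists>x\<in>S. x n = 0 \<and> (\<forall>y\<in>S. y \<noteq> x \<longrightarrow> y n \<noteq> 0)) \<and>
          (\<forall>m<n. \<forall>x\<in>S. \<forall>y\<in>S. x m = y m))"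

lemma lone_zero_at_branching:
  assumes prefix: "\<And>z. z \<in> A \<union> B \<Longrightarrow> prefix n z = u"
    and A: "A \<noteq> {}" "\<And>z. z \<in> A \<Longrightarrow> z n = 0"
    and B: "B \<noteq> {}" "\<And>z. z \<in> B \<Longrightarrow> z n = 1"
  shows "lone_zero (A \<union> B) \<longleftrightarrow> is_singleton A"
proof -
  have agree: "x m = y m" if "x \<in> A \<union> B" "y \<in> A \<union> B" "m < n" for x y m
  proof -
    have "prefix n x = prefix n y"
      using prefix that by simp
    then have "prefix n x ! m = prefix n y ! m"
      by simp
    then show ?thesis
      using \<open>m < n\<close> by simp
  qed
  obtain a b where ab: "a \<in> A" "b \<in> B"
    using A B by blast
  show ?thesis
  proof
    assume "lone_zero (A \<union> B)"
    then obtain p x where p: "x \<in> A \<union> B" "x p = 0" "\<forall>y\<in>A \<union> B. y \<noteq> x \<longrightarrow> y p \<noteq> 0"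
      "\<forall>m<p. \<forall>x\<in>A \<union> B. \<forall>y\<in>A \<union> B. x m = y m"
      unfolding lone_zero_def by blast
    \<comment> \<open>A witness \<open>p\<close> can only be \<open>n\<close>: beyond
      \<open>n\<close>, the members would have to agree at \<open>n\<close>, where \<open>a\<close>
      and \<open>b\<close> differ; before \<open>n\<close>, both \<open>a\<close> and
      \<open>b\<close> share the zero of \<open>x\<close>, which is then not alone.\<close>
    have "\<not> n < p"
      using p(4) ab A(2)[OF ab(1)] B(2)[OF ab(2)] by (metis UnI1 UnI2 zero_neq_one)
    moreover have "\<not> p < n"
    proof
      assume "p < n"
      have "a \<noteq> b"
        using A(2)[OF ab(1)] B(2)[OF ab(2)] by auto
      moreover have "a p = x p" "b p = x p"
        using agree ab p(1) \<open>p < n\<close> by auto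
      ultimately show False
        using p ab by (metis UnI1 UnI2)
    qed
    ultimately have "p = n"
      by simp
    then have "A = {x}"
      using p(1-3) A B(2) by force
    then show "is_singleton A"
      by simp
  next
    assume "is_singleton A"
    then obtain x where "A = {x}"
      by (rule is_singletonE)
    with A have "x n = 0" "x \<in> A \<union> B"
      by auto
    moreover have "\<forall>y\<in>A \<union> B. y \<noteq> x \<longrightarrow> y n \<noteq> 0"
      using \<open>A = {x}\<close> B(2) by (metis UnE singletonD zero_neq_one)
    ultimately show "lone_zero (A \<union> B)"
      using agree unfolding lone_zero_def by blast
  qed
qed

lemma uncountable_both_colours:
  assumes "uncountable H" and "H \<subseteq> {w. \<forall>n. w n \<in> {0, 1}}" and "k \<ge> 3"
  obtains S T where "S \<in> nsets H k" "lone_zero S" "T \<in> nsets H k" "\<not> lone_zero T"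
proof -
  obtain n u where inf: "infinite {z \<in> H. prefix n z = u \<and> z n = 0}"
    "infinite {z \<in> H. prefix n z = u \<and> z n = 1}"
    using uncountable_branching[OF assms(1,2)] .
  \<comment> \<open>\<open>a\<close> is the number of members taken from the 0-side. The values 1
    and 2 will give the two colours; \<open>k \<ge> 3\<close> leaves a member for the 1-side in both
    cases.\<close>
  have mix: "\<exists>S \<in> nsets H k. lone_zero S \<longleftrightarrow> a = 1" if "0 < a" "a < k" for a
  proof -
    obtain A where A: "finite A" "card A = a" "A \<subseteq> {z \<in> H. prefix n z = u \<and> z n = 0}"
      using infinite_arbitrarily_large[OF inf(1)] by blast
    obtain B where B: "finite B" "card B = k - a" "B \<subseteq> {z \<in> H. prefix n z = u \<and> z n = 1}"
      using infinite_arbitrarily_large[OF inf(2)] by blast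
    have "A \<inter> B = {}"
      using A(3) B(3) by force
    then have "A \<union> B \<in> nsets H k"
      using A B that by (auto simp: nsets_def card_Un_disjoint)
    moreover have "lone_zero (A \<union> B) \<longleftrightarrow> is_singleton A"
      using A B that by (intro lone_zero_at_branching[of A B n u]) auto
    ultimately show ?thesis
      using A(2) by (auto simp: is_singleton_altdef)
  qed
  obtain S where "S \<in> nsets H k" "lone_zero S"
    using mix[of 1] assms(3) by auto
  moreover obtain T where "T \<in> nsets H k" "\<not> lone_zero T"
    using mix[of 2] assms(3) by auto
  ultimately show thesis
    using that by blast
qed


section \<open>Deterministic automata whose runs become constant\<close>

text \<open>If the deterministic run settles on the state \<open>\<rho>' w\<close>, its limit set is
  a singleton, and Buchi acceptance only asks whether that state is final. Taking the run as a
  function lets applications supply it in closed form.\<close>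

lemma omega_regular_eventually_constant:
  fixes \<rho> :: "'a word \<Rightarrow> 'q word"
  assumes "finite \<Sigma>" "finite Q" "q0 \<in> Q"
    and closed: "\<And>q a. q \<in> Q \<Longrightarrow> a \<in> \<Sigma> \<Longrightarrow> \<delta> q a \<in> Q"
    and run0: "\<And>w. \<rho> w 0 = q0"
    and step: "\<And>w n. (\<And>m. w m \<in> \<Sigma>) \<Longrightarrow> \<rho> w (Suc n) = \<delta> (\<rho> w n) (w n)"
    and const: "\<And>w. (\<And>m. w m \<in> \<Sigma>) \<Longrightarrow> \<forall>\<^sub>\<infinity>n. \<rho> w n = \<rho>' w"
  shows "omega_regular \<Sigma> {w. (\<forall>n. w n \<in> \<Sigma>) \<and> \<rho>' w \<in> F}"
proof -
  obtain e :: "'q \<Rightarrow> nat" where e: "inj_on e Q"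
    using finite_imp_inj_to_nat_seg[OF \<open>finite Q\<close>] by blast
  \<comment> \<open>Only \<open>F \<inter> Q\<close> is encoded: \<open>e\<close> is injective just
    on \<open>Q\<close>, and codes of other members of \<open>F\<close> could collide with codes of
    states.\<close>
  define A where "A = \<lparr>states = e ` Q, initial = {e q0},
    transitions = {(e q, a, e (\<delta> q a)) | q a. q \<in> Q \<and> a \<in> \<Sigma>}, final = e ` (F \<inter> Q)\<rparr>"
  have aut: "buchi_automaton \<Sigma> A"
    using assms(1-3) closed unfolding buchi_automaton_def A_def by auto
  have in_Q: "\<rho> w n \<in> Q" if "\<And>m. w m \<in> \<Sigma>" for w n
    by (induction n) (auto simp: run0 assms(3) step that closed)
  have run_iff: "accepting_run A w r \<longleftrightarrow>
      (\<forall>n. w n \<in> \<Sigma>) \<and> r = (\<lambda>n. e (\<rho> w n)) \<and> \<rho>' w \<in> F" for w r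
  proof -
    have lim: "limit (\<lambda>n. e (\<rho> w n)) \<inter> e ` (F \<inter> Q) \<noteq> {} \<longleftrightarrow> \<rho>' w \<in> F"
      if w: "\<forall>n. w n \<in> \<Sigma>"
    proof -
      have ev: "\<forall>\<^sub>\<infinity>n. \<rho> w n = \<rho>' w"
        using const w by blast
      then obtain n where "\<rho> w n = \<rho>' w"
        by (auto simp: MOST_nat)
      then have "\<rho>' w \<in> Q"
        using in_Q w by metis
      have "limit (\<lambda>n. e (\<rho> w n)) = {e (\<rho>' w)}"
      proof -
        have ev': "\<forall>\<^sub>\<infinity>n. e (\<rho> w n) = e (\<rho>' w)"
          using ev by (rule MOST_mono) simp
        have "(\<exists>\<^sub>\<infinity>n. e (\<rho> w n) = p) \<longleftrightarrow> p = e (\<rho>' w)" for p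
        proof
          assume "\<exists>\<^sub>\<infinity>n. e (\<rho> w n) = p"
          then obtain n where "e (\<rho> w n) = p \<and> e (\<rho> w n) = e (\<rho>' w)"
            using INFM_conjI[OF _ ev'] by (auto dest: INFM_EX)
          then show "p = e (\<rho>' w)"
            by simp
        next
          assume "p = e (\<rho>' w)"
          then show "\<exists>\<^sub>\<infinity>n. e (\<rho> w n) = p"
            using ev' by (simp add: MOST_INFM)
        qed
        then show ?thesis
          unfolding limit_def by simp
      qed
      then show ?thesis
        using \<open>\<rho>' w \<in> Q\<close> inj_on_image_mem_iff[OF e \<open>\<rho>' w \<in> Q\<close>, of "F \<inter> Q"] by auto
    qed
    show ?thesis
    proof
      assume acc: "accepting_run A w r"
      then have r0: "r 0 = e q0"
        and tr: "\<And>n. \<exists>q\<in>Q. r n = e q \<and> w n \<in> \<Sigma> \<and> r (Suc n) = e (\<delta> q (w n))"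
        unfolding accepting_run_def A_def by auto
      have w: "\<forall>n. w n \<in> \<Sigma>"
        using tr by blast
      \<comment> \<open>Injectivity of \<open>e\<close> recovers the source state of each
        transition, so determinism leaves a single run.\<close>
      have "r n = e (\<rho> w n)" for n
      proof (induction n)
        case 0
        then show ?case
          by (simp add: r0 run0)
      next
        case (Suc n)
        obtain q where q: "q \<in> Q" "r n = e q" "r (Suc n) = e (\<delta> q (w n))"
          using tr by blast
        then have "q = \<rho> w n"
          using Suc in_Q w e by (metis inj_onD)
        then show ?case
          using q step w by simp
      qed
      then have r: "r = (\<lambda>n. e (\<rho> w n))"
        by blast
      moreover have "\<rho>' w \<in> F"
        using acc lim[OF w] unfolding accepting_run_def A_def r by simp
      ultimately show "(\<forall>n. w n \<in> \<Sigma>) \<and> r = (\<lambda>n. e (\<rho> w n)) \<and> \<rho>' w \<in> F"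
        using w by blast
    next
      assume *: "(\<forall>n. w n \<in> \<Sigma>) \<and> r = (\<lambda>n. e (\<rho> w n)) \<and> \<rho>' w \<in> F"
      then have "(r n, w n, r (Suc n)) \<in> transitions A" for n
        using in_Q[of w n] step[of w n] unfolding A_def by auto
      with * lim show "accepting_run A w r"
        unfolding accepting_run_def A_def by (auto simp: run0)
    qed
  qed
  have "buchi_language A = {w. (\<forall>n. w n \<in> \<Sigma>) \<and> \<rho>' w \<in> F}"
    unfolding buchi_language_def run_iff by blast
  with aut show ?thesis
    unfolding omega_regular_def by blast
qed

lemma omega_regular_full:
  assumes "finite \<Sigma>"
  shows "omega_regular \<Sigma> {w. \<forall>n. w n \<in> \<Sigma>}"
  using omega_regular_eventually_constant[OF assms, of "{()}" "()" "\<lambda>_ _. ()" "\<lambda>_ _. ()" "\<lambda>_. ()" UNIV]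
  by simp

text \<open>Every word over the product alphabet splits into \<open>k\<close> tracks whose
  convolution is that word. A condition on tuples that is stated through the convolution thus
  becomes the same condition on words.\<close>

lemma convolution_image:
  "convolution ` {xs. length xs = k \<and> set xs \<subseteq> {x. \<forall>n. x n \<in> \<Sigma>} \<and> P (convolution xs)} =
   {w. (\<forall>n. w n \<in> product_alphabet \<Sigma> k) \<and> P w}"
proof (intro equalityI subsetI)
  fix w assume "w \<in> {w. (\<forall>n. w n \<in> product_alphabet \<Sigma> k) \<and> P w}"
  then have w: "\<And>n. length (w n) = k" "\<And>n. set (w n) \<subseteq> \<Sigma>" "P w"
    by (auto simp: product_alphabet_def)
  define xs where "xs = map (\<lambda>i n. w n ! i) [0..<k]"
  have conv: "convolution xs = w"
    using w(1) by (auto simp: convolution_def xs_def intro!: ext nth_equalityI)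
  have "set xs \<subseteq> {x. \<forall>n. x n \<in> \<Sigma>}"
    using w(1,2) nth_mem by (fastforce simp: xs_def)
  then show "w \<in> convolution `
      {xs. length xs = k \<and> set xs \<subseteq> {x. \<forall>n. x n \<in> \<Sigma>} \<and> P (convolution xs)}"
    using conv w(3) by (intro image_eqI[of _ _ xs]) (auto simp: xs_def)
qed (auto simp: convolution_def product_alphabet_def subset_iff)


section \<open>Recognising the colour of a tuple\<close>

definition lone_zero_letter :: "nat list \<Rightarrow> bool" where
  "lone_zero_letter a \<longleftrightarrow>
     (\<exists>i<length a. a ! i = 0 \<and> (\<forall>j<length a. j \<noteq> i \<longrightarrow> a ! j \<noteq> 0))"

text \<open>Polymorphic in order to compare both the entries of one letter and the components of a
  tuple of words.\<close>

definition differing_pairs :: "'a list \<Rightarrow> (nat \<times> nat) set" where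
  "differing_pairs a = {(i, j). i < length a \<and> j < length a \<and> a ! i \<noteq> a ! j}"

definition first_split_lone_zero :: "nat list word \<Rightarrow> bool" where
  "first_split_lone_zero w \<longleftrightarrow>
     (\<exists>n. lone_zero_letter (w n) \<and> (\<forall>m<n. differing_pairs (w m) = {}))"

text \<open>The state holds the pairs of tracks seen to differ and a flag for a lone zero at a
  position before which all tracks agreed. Both only grow, within finite bounds, so the run settles.
  The set \<open>F\<close> is arbitrary, to cover the colour classes and equality alike.\<close>

lemma omega_automatic_colour:
  fixes \<Sigma> :: "nat set" and F :: "((nat \<times> nat) set \<times> bool) set"
  assumes "finite \<Sigma>"
  shows "omega_automatic \<Sigma> k {xs. length xs = k \<and> set xs \<subseteq> {x. \<forall>n. x n \<in> \<Sigma>} \<and>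
    (differing_pairs xs, first_split_lone_zero (convolution xs)) \<in> F}"
proof -
  define D where "D w n = (\<Union>m<n. differing_pairs (w m))" for w :: "nat list word" and n
  define C where "C w n = (\<exists>p<n. lone_zero_letter (w p) \<and> (\<forall>m<p. differing_pairs (w m) = {}))"
    for w :: "nat list word" and n
  define D' where "D' w = (\<Union>m. differing_pairs (w m))" for w :: "nat list word"
  define \<Gamma> where "\<Gamma> = product_alphabet \<Sigma> k"
  define Q :: "((nat \<times> nat) set \<times> bool) set" where "Q = Pow ({..<k} \<times> {..<k}) \<times> UNIV"
  \<comment> \<open>The flag tests the pairs collected before the current letter, since the letter
    with the lone zero may itself be the first to split the tracks.\<close>
  define \<delta> where "\<delta> q a = (fst q \<union> differing_pairs a,
    snd q \<or> fst q = {} \<and> lone_zero_letter a)" for q a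
  have sub: "differing_pairs a \<subseteq> {..<k} \<times> {..<k}" if "a \<in> \<Gamma>" for a
    using that by (auto simp: differing_pairs_def \<Gamma>_def product_alphabet_def)
  have "omega_regular \<Gamma> {w. (\<forall>n. w n \<in> \<Gamma>) \<and> (D' w, first_split_lone_zero w) \<in> F}"
  proof (rule omega_regular_eventually_constant[of \<Gamma> Q "({}, False)" \<delta> "\<lambda>w n. (D w n, C w n)"])
    show "finite \<Gamma>"
      using finite_lists_length_eq[OF assms, of k]
      by (simp add: \<Gamma>_def product_alphabet_def conj_commute)
    show "\<delta> q a \<in> Q" if "q \<in> Q" "a \<in> \<Gamma>" for q a
      using that sub[of a] by (auto simp: \<delta>_def Q_def)
    show "(D w (Suc n), C w (Suc n)) = \<delta> (D w n, C w n) (w n)" for w n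
      by (auto simp: D_def C_def \<delta>_def less_Suc_eq)
    show "\<forall>\<^sub>\<infinity>n. (D w n, C w n) = (D' w, first_split_lone_zero w)" if w: "\<And>m. w m \<in> \<Gamma>" for w
    proof -
      \<comment> \<open>Each pair in \<open>D' w\<close> is present from some point on; finiteness
        yields one point common to all of them.\<close>
      have "finite (D' w)"
        using sub w by (intro finite_subset[of "D' w" "{..<k} \<times> {..<k}"]) (auto simp: D'_def)
      moreover have "\<forall>d \<in> D' w. \<forall>\<^sub>\<infinity>n. d \<in> D w n"
      proof
        fix d assume "d \<in> D' w"
        then obtain m where "d \<in> differing_pairs (w m)"
          by (auto simp: D'_def)
        then show "\<forall>\<^sub>\<infinity>n. d \<in> D w n"
          unfolding MOST_nat D_def by blast
      qed
      ultimately have "\<forall>\<^sub>\<infinity>n. \<forall>d \<in> D' w. d \<in> D w n"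
        by (simp add: eventually_ball_finite cofinite_eq_sequentially)
      moreover have "D w n \<subseteq> D' w" for n
        by (auto simp: D_def D'_def)
      ultimately have "\<forall>\<^sub>\<infinity>n. D w n = D' w"
        by (metis (mono_tags, lifting) MOST_mono subsetI subset_antisym)
      \<comment> \<open>A position witnessing the colour raises the flag for good; without one the
        flag is never raised.\<close>
      moreover have "\<forall>\<^sub>\<infinity>n. C w n = first_split_lone_zero w"
        unfolding MOST_nat C_def first_split_lone_zero_def by blast
      ultimately show ?thesis
        by (simp add: MOST_conj_distrib)
    qed
  qed (auto simp: assms Q_def D_def C_def)
  moreover have "differing_pairs xs = D' (convolution xs)" for xs :: "nat word list"
    by (auto simp: differing_pairs_def D'_def convolution_def fun_eq_iff)
  ultimately show ?thesis
    unfolding omega_automatic_def \<Gamma>_def convolution_image[symmetric] by simp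
qed

text \<open>\<open>lone_zero\<close> excludes a zero in other elements,
  \<open>lone_zero_letter\<close> at other indices; without repetitions these are the same.\<close>

lemma lone_zero_distinct:
  assumes "distinct xs"
  shows "lone_zero (set xs) \<longleftrightarrow> first_split_lone_zero (convolution xs)"
proof -
  have "(\<exists>x\<in>set xs. x n = 0 \<and> (\<forall>y\<in>set xs. y \<noteq> x \<longrightarrow> y n \<noteq> 0)) \<longleftrightarrow>
      lone_zero_letter (convolution xs n)" for n
  proof -
    have "(\<exists>x\<in>set xs. R x) \<longleftrightarrow> (\<exists>i<length xs. R (xs ! i))" for R
      using all_set_conv_all_nth[of xs "\<lambda>x. \<not> R x"] by blast
    then show ?thesis
      using assms by (auto simp: lone_zero_letter_def convolution_def all_set_conv_all_nth
          nth_eq_iff_index_eq cong: conj_cong)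
  qed
  moreover have "(\<forall>x\<in>set xs. \<forall>y\<in>set xs. x m = y m) \<longleftrightarrow>
      differing_pairs (convolution xs m) = {}" for m
    unfolding all_set_conv_all_nth by (auto simp: differing_pairs_def convolution_def)
  ultimately show ?thesis
    unfolding lone_zero_def first_split_lone_zero_def by simp
qed

text \<open>Lets the automaton check that a tuple really enumerates a set of \<open>k\<close>
  words.\<close>

lemma distinct_iff_differing_pairs:
  "distinct xs \<longleftrightarrow>
    differing_pairs xs = {(i, j). i < length xs \<and> j < length xs \<and> i \<noteq> j}"
  by (auto simp: differing_pairs_def distinct_conv_nth)

section \<open>Size of the domain and assembly of the presentation\<close>

lemma card_binary_words: "|{w :: nat word. \<forall>n. w n \<in> {0, 1}}| =o ctwo ^c natLeq"
proof -
  have "bij_betw (\<lambda>f n. of_bool (f n)) (UNIV :: bool word set) {w :: nat word. \<forall>n. w n \<in> {0, 1}}"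
    by (rule bij_betwI[where g = "\<lambda>w n. w n = 1"]) (auto simp: fun_eq_iff)
  then have "|UNIV :: bool word set| =o |{w :: nat word. \<forall>n. w n \<in> {0, 1}}|"
    using card_of_ordIso by blast
  moreover have "ctwo ^c natLeq = |UNIV :: bool word set|"
    by (simp add: cexp_def ctwo_def Func_def Field_card_of Field_natLeq)
  ultimately show ?thesis
    using ordIso_symmetric by simp
qed

theorem theorem3p11:
  fixes k l :: nat and \<kappa> :: "'c rel"
  assumes "k \<ge> 3" and "l \<ge> 2"
    and "Card_order \<kappa>" and "natLeq <o \<kappa>"
  shows "\<exists>(V :: nat word set) (E :: nat \<Rightarrow> nat word set set)
            (L :: nat word set) (h :: nat word \<Rightarrow> nat word).
           kl_partition k l V E \<and>
           |V| =o ctwo ^c natLeq \<and>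
           injective_omega_automatic_presentation k l V E L h \<and>
           \<not> (\<exists>H \<subseteq> L. homogeneous k l V E (h ` H) \<and> |h ` H| =o \<kappa>)"
proof -
  define V :: "nat word set" where "V = {w. \<forall>n. w n \<in> {0, 1}}"
  \<comment> \<open>Two classes carry the colouring; for larger \<open>l\<close> the remaining ones
    are empty.\<close>
  define E where "E i = (if i = 1 then {S \<in> nsets V k. lone_zero S}
    else if i = 2 then {S \<in> nsets V k. \<not> lone_zero S} else {})" for i :: nat
  have part: "kl_partition k l V E"
  proof -
    have "E 1 \<union> E 2 = nsets V k"
      by (auto simp: E_def)
    moreover have "E 1 \<subseteq> (\<Union>i\<in>{1..l}. E i)" "E 2 \<subseteq> (\<Union>i\<in>{1..l}. E i)"
      using \<open>l \<ge> 2\<close> by (intro UN_upper; simp)+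
    moreover have "(\<Union>i\<in>{1..l}. E i) \<subseteq> nsets V k"
      by (auto simp: E_def split: if_splits)
    moreover have "disjoint_family_on E {1..l}"
      by (auto simp: disjoint_family_on_def E_def)
    ultimately show ?thesis
      unfolding kl_partition_def by blast
  qed
  have classes: "omega_automatic {0, 1} k
      {xs. length xs = k \<and> set xs \<subseteq> V \<and> id ` set xs \<in> E i}" for i
  proof -
    \<comment> \<open>The first component demands that all tracks differ pairwise, the flag
      \<open>c\<close> selects the class; for \<open>i\<close> other than 1 and 2 the set is
      empty.\<close>
    define F where "F = {({(a, b). a < k \<and> b < k \<and> a \<noteq> b}, c) | c. i = (if c then 1 else 2)}"
    have "id ` set xs \<in> E i \<longleftrightarrow>
        (differing_pairs xs, first_split_lone_zero (convolution xs)) \<in> F"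
      if xs: "length xs = k" "set xs \<subseteq> V" for xs
    proof -
      have "set xs \<in> nsets V k \<longleftrightarrow> distinct xs"
        using xs by (auto simp: nsets_def card_distinct distinct_card)
      then have "id ` set xs \<in> E i \<longleftrightarrow> distinct xs \<and> i = (if lone_zero (set xs) then 1 else 2)"
        by (auto simp: E_def)
      then show ?thesis
        using lone_zero_distinct[of xs] distinct_iff_differing_pairs[of xs] xs(1)
        by (auto simp: F_def)
    qed
    then have "{xs. length xs = k \<and> set xs \<subseteq> V \<and> id ` set xs \<in> E i} =
      {xs. length xs = k \<and> set xs \<subseteq> V \<and>
        (differing_pairs xs, first_split_lone_zero (convolution xs)) \<in> F}"
      by blast
    then show ?thesis
      unfolding V_def by (simp only: omega_automatic_colour finite.intros)
  qed
  have equality: "omega_automatic {0, 1} 2 {[x, y] | x y. x \<in> V \<and> y \<in> V \<and> id x = id y}"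
  proof -
    \<comment> \<open>Two words are equal when no pair of tracks ever differs, whatever the flag
      says.\<close>
    have "{[x, y] | x y. x \<in> V \<and> y \<in> V \<and> id x = id y} =
      {xs. length xs = 2 \<and> set xs \<subseteq> V \<and>
        (differing_pairs xs, first_split_lone_zero (convolution xs)) \<in> {{}} \<times> UNIV}"
    proof -
      have pair: "length xs = 2 \<longleftrightarrow> (\<exists>x y. xs = [x, y])" for xs :: "nat word list"
        by (auto simp: numeral_2_eq_2 length_Suc_conv)
      have diff: "differing_pairs [x, y] = {} \<longleftrightarrow> x = y" for x y :: "nat word"
        by (force simp: differing_pairs_def less_Suc_eq)
      show ?thesis
        unfolding pair by (intro Collect_cong) (simp, metis diff list.simps(15)
            insert_subset empty_set empty_subsetI)
    qed
    then show ?thesis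
      unfolding V_def by (simp only: omega_automatic_colour finite.intros)
  qed
  have pres: "injective_omega_automatic_presentation k l V E V id"
    unfolding injective_omega_automatic_presentation_def
    using classes equality omega_regular_full[of "{0, 1 :: nat}"]
    by (intro exI[of _ "{0, 1}"]) (simp add: V_def)
  have "\<not> homogeneous k l V E H" if "H \<subseteq> V" "|H| =o \<kappa>" for H
  proof
    assume "homogeneous k l V E H"
    then obtain i where i: "nsets H k \<subseteq> E i"
      unfolding homogeneous_def by blast
    have "uncountable H"
    proof
      assume "countable H"
      then have "|H| \<le>o natLeq"
        by (simp add: countable_card_le_natLeq)
      then have "\<kappa> \<le>o natLeq"
        using that(2) ordIso_ordLeq_trans ordIso_symmetric by blast
      with assms(4) show False
        using not_ordLess_ordLeq by blast
    qed
    then obtain S T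
      where "S \<in> nsets H k" "lone_zero S" "T \<in> nsets H k" "\<not> lone_zero T"
      using uncountable_both_colours \<open>H \<subseteq> V\<close> \<open>k \<ge> 3\<close> unfolding V_def by metis
    \<comment> \<open>Membership of \<open>S\<close> forces \<open>i = 1\<close>, that of
      \<open>T\<close> forces \<open>i = 2\<close>.\<close>
    with i have "S \<in> E i" "T \<in> E i"
      by auto
    with \<open>lone_zero S\<close> \<open>\<not> lone_zero T\<close> show False
      by (auto simp: E_def split: if_splits)
  qed
  then have "\<not> (\<exists>H \<subseteq> V. homogeneous k l V E (id ` H) \<and> |id ` H| =o \<kappa>)"
    by auto
  with part pres card_binary_words show ?thesis
    unfolding V_def[symmetric] by blast
qed

end
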